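(* Let $G=(V,E)$ be a locally finite, simple, strongly connected directed graph which is $d$-regular, i.e. $d_x=d$ for all $x\in V$. Assume (a): for every edge $(x,y)\in E$, $\Gamma^{\mathrm{out}}(x)\cap\Gamma^{\mathrm{out}}(y)=\emptyset$. Then: 1. There exists an edge $(x,y)$ of $G$ with $\kappa(x,y)\le 0$. 2. If $\kappa(x,y)\ge0$ for every edge $(x,y)$ of $G$, then $G$ is Ricci-flat. 3. If $G$ is Ricci-flat, then all vertices of $G$ have the same out-degree. 4. If (1) all vertices of $G$ have the same out-degree, and (2) for every edge $(u,v)\in E$ there exists a bijection $\phi:\Gamma^{\mathrm{out}}(u)\to\Gamma^{\mathrm{out}}(v)$ with $d(x,\phi(x))=1$ for all $x\in\Gamma^{\mathrm{out}}(u)$, then $G$ is Ricci-flat.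
   Context: $(x,y)$ denotes a directed edge from $x$ to $y$. Strongly connected: a directed path exists between any two vertices. The distance $d(x,y)$ is the length of a shortest directed path from $x$ to $y$. $\Gamma^{\mathrm{in}}(x)=\{y:(y,x)\in E\}$, $\Gamma^{\mathrm{out}}(x)=\{y:(x,y)\in E\}$, $\Gamma(x)=\Gamma^{\mathrm{in}}(x)\cup\Gamma^{\mathrm{out}}(x)$; degree $d_x=|\Gamma(x)|$, in-degree $d_x^{\mathrm{in}}=|\Gamma^{\mathrm{in}}(x)|$, out-degree $d_x^{\mathrm{out}}=|\Gamma^{\mathrm{out}}(x)|$. For $\alpha\in[0,1]$, $m_x^\alpha(x)=\alpha+\frac{1-\alpha}{d_x}d_x^{\mathrm{in}}$, $m_x^\alpha(v)=\frac{1-\alpha}{d_x}$ if $(x,v)\in E$, $0$ otherwise. $W(m_x^\alpha,m_y^\alpha)=\inf_A\sum_{u,v}A(u,v)d(u,v)$ over couplings $A:V\times V\to[0,1]$ with $\sum_vA(u,v)=m_x^\alpha(u)$, $\sum_uA(u,v)=m_y^\alpha(v)$. $\kappa_\alpha(x,y)=1-W(m_x^\alpha,m_y^\alpha)/d(x,y)$ and $\kappa(x,y)=\lim_{\alpha\to1}\kappa_\alpha(x,y)/(1-\alpha)$ (the limit exists). $G$ is Ricci-flat if $\kappa(x,y)=0$ for every edge $(x,y)\in E$. *)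

theory Defs
  imports "HOL-Analysis.Analysis" "Graph_Theory.Graph_Theory"
begin

text \<open>
  Directed graphs are the library's \<^typ>\<open>'a pair_pre_digraph\<close>: the vertex set is
  \<^term>\<open>pverts G\<close>, the edge set \<^term>\<open>parcs G\<close> is a set of pairs (so there are no
  parallel edges), and \<^term>\<open>pverts G\<close> may be infinite.
\<close>

text \<open>
  Simple: no loops and at most one edge between two vertices, so \<open>(x,y)\<close> and \<open>(y,x)\<close> are
  not both edges. This is what makes the in- and the out-neighbourhood of a vertex disjoint and
  hence the measure \<open>vmeasure\<close> below a probability measure.
\<close>
definition simple_digraph :: "'a pair_pre_digraph \<Rightarrow> bool" where
  "simple_digraph G \<longleftrightarrow> pair_loopfree_digraph G \<and> antisym (parcs G)"

definition nbr_in :: "'a pair_pre_digraph \<Rightarrow> 'a \<Rightarrow> 'a set" where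
  "nbr_in G x = {y. (y, x) \<in> parcs G}"

definition nbr_out :: "'a pair_pre_digraph \<Rightarrow> 'a \<Rightarrow> 'a set" where
  "nbr_out G x = {y. (x, y) \<in> parcs G}"

definition nbr :: "'a pair_pre_digraph \<Rightarrow> 'a \<Rightarrow> 'a set" where
  "nbr G x = nbr_in G x \<union> nbr_out G x"

definition deg :: "'a pair_pre_digraph \<Rightarrow> 'a \<Rightarrow> nat" where
  "deg G x = card (nbr G x)"

definition deg_in :: "'a pair_pre_digraph \<Rightarrow> 'a \<Rightarrow> nat" where
  "deg_in G x = card (nbr_in G x)"

definition deg_out :: "'a pair_pre_digraph \<Rightarrow> 'a \<Rightarrow> nat" where
  "deg_out G x = card (nbr_out G x)"

definition locally_finite_digraph :: "'a pair_pre_digraph \<Rightarrow> bool" where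
  "locally_finite_digraph G \<longleftrightarrow> (\<forall>x\<in>pverts G. finite (nbr G x))"

text \<open>Meaningful if \<open>y\<close> is reachable from \<open>x\<close>.\<close>
definition gdist :: "'a pair_pre_digraph \<Rightarrow> 'a \<Rightarrow> 'a \<Rightarrow> nat" where
  "gdist G x y = (LEAST n. \<exists>p. pre_digraph.apath (with_proj G) x p y \<and> length p = n)"

definition vmeasure :: "'a pair_pre_digraph \<Rightarrow> real \<Rightarrow> 'a \<Rightarrow> 'a \<Rightarrow> real" where
  "vmeasure G \<alpha> x v =
     (if v = x then \<alpha> + (1 - \<alpha>) / real (deg G x) * real (deg_in G x)
      else if (x, v) \<in> parcs G then (1 - \<alpha>) / real (deg G x)
      else 0)"

definition couplings ::
  "'a pair_pre_digraph \<Rightarrow> ('a \<Rightarrow> real) \<Rightarrow> ('a \<Rightarrow> real) \<Rightarrow> ('a \<times> 'a \<Rightarrow> real) set" where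
  "couplings G \<mu> \<nu> =
     {A. (\<forall>u\<in>pverts G. \<forall>v\<in>pverts G. 0 \<le> A (u, v) \<and> A (u, v) \<le> 1) \<and>
         (\<forall>u\<in>pverts G. ((\<lambda>v. A (u, v)) has_sum \<mu> u) (pverts G)) \<and>
         (\<forall>v\<in>pverts G. ((\<lambda>u. A (u, v)) has_sum \<nu> v) (pverts G))}"

text \<open>
  On a locally finite graph the measures \<open>vmeasure G \<alpha> x\<close> have finite support, so couplings of
  two of them vanish outside a finite subset of \<open>pverts G \<times> pverts G\<close> and the sum converges.
\<close>
definition wasserstein ::
  "'a pair_pre_digraph \<Rightarrow> ('a \<Rightarrow> real) \<Rightarrow> ('a \<Rightarrow> real) \<Rightarrow> real" where
  "wasserstein G \<mu> \<nu> =
     (INF A\<in>couplings G \<mu> \<nu>.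
        \<Sum>\<^sub>\<infinity>(u, v)\<in>pverts G \<times> pverts G. A (u, v) * real (gdist G u v))"

definition curvature_alpha :: "'a pair_pre_digraph \<Rightarrow> real \<Rightarrow> 'a \<Rightarrow> 'a \<Rightarrow> real" where
  "curvature_alpha G \<alpha> x y =
     1 - wasserstein G (vmeasure G \<alpha> x) (vmeasure G \<alpha> y) / real (gdist G x y)"

text \<open>The limit is one-sided, since \<open>\<alpha>\<close> ranges over \<open>[0,1]\<close>.\<close>
definition curvature :: "'a pair_pre_digraph \<Rightarrow> 'a \<Rightarrow> 'a \<Rightarrow> real" where
  "curvature G x y = Lim (at_left 1) (\<lambda>\<alpha>. curvature_alpha G \<alpha> x y / (1 - \<alpha>))"

definition ricci_flat :: "'a pair_pre_digraph \<Rightarrow> bool" where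
  "ricci_flat G \<longleftrightarrow> (\<forall>(x, y)\<in>parcs G. curvature G x y = 0)"

end

theory Submission
  imports Defs
begin

text \<open>
  Testing Kantorovich duality against the 1-Lipschitz function \<open>d(x, \<cdot>)\<close>, which equals 2 on
  \<open>\<Gamma>\<^sup>o\<^sup>u\<^sup>t(y)\<close> by (a), gives \<open>d * \<kappa>(x,y) \<le> d\<^sub>x\<^sup>o\<^sup>u\<^sup>t - d\<^sub>y\<^sup>o\<^sup>u\<^sup>t\<close> for every edge \<open>(x,y)\<close>. Hence nonnegative
  curvature makes the out-degree nonincreasing along edges, so constant by strong connectedness,
  whereas positive curvature on all edges would make it strictly decreasing along an infinite walk.
  Under the assumptions of part 4, moving \<open>\<Gamma>\<^sup>o\<^sup>u\<^sup>t(x)\<close> along the bijection and the remaining mass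
  from \<open>x\<close> to \<open>y\<close> is a transport of cost 1. The limit defining \<open>\<kappa>\<close> exists since mixing a coupling
  with the point mass at \<open>(x,y)\<close> shows that \<open>\<kappa>\<^sub>\<alpha>(x,y) / (1 - \<alpha>)\<close> is monotone in \<open>\<alpha>\<close>.
\<close>

section \<open>Couplings of finitely supported measures\<close>

abbreviation transport_cost :: "'a pair_pre_digraph \<Rightarrow> ('a \<times> 'a \<Rightarrow> real) \<Rightarrow> real" where
  "transport_cost G A \<equiv>
     \<Sum>\<^sub>\<infinity>(u, v)\<in>pverts G \<times> pverts G. A (u, v) * real (gdist G u v)"

text \<open>Nonnegative terms with sum 0 all vanish. This confines a coupling to the product of the
  supports and turns the infinite sums into finite ones.\<close>

lemma coupling_eq_0:
  assumes "A \<in> couplings G \<mu> \<nu>" "u \<in> pverts G" "v \<in> pverts G" "\<mu> u = 0 \<or> \<nu> v = 0"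
  shows "A (u, v) = 0"
  using assms(4)
proof
  assume "\<mu> u = 0"
  then show ?thesis
    using nonneg_has_sum_le_0D[of "\<lambda>v. A (u, v)" "pverts G" "\<mu> u" v] assms
    by (auto simp: couplings_def)
next
  assume "\<nu> v = 0"
  then show ?thesis
    using nonneg_has_sum_le_0D[of "\<lambda>u. A (u, v)" "pverts G" "\<nu> v" u] assms
    by (auto simp: couplings_def)
qed

text \<open>\<open>S\<close> and \<open>T\<close> need only contain the supports, so that one pair
  of sets can serve a whole family of measures.\<close>

locale finite_supports =
  fixes G :: "'a pair_pre_digraph" and \<mu> \<nu> :: "'a \<Rightarrow> real" and S T :: "'a set"
  assumes fin: "finite S" "finite T"
    and sub: "S \<subseteq> pverts G" "T \<subseteq> pverts G"
    and supp: "\<And>u. u \<in> pverts G \<Longrightarrow> u \<notin> S \<Longrightarrow> \<mu> u = 0" "\<And>v. v \<in> pverts G \<Longrightarrow> v \<notin> T \<Longrightarrow> \<nu> v = 0"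
begin

lemma sum_row:
  assumes "A \<in> couplings G \<mu> \<nu>" "u \<in> pverts G"
  shows "(\<Sum>v\<in>T. A (u, v)) = \<mu> u"
proof -
  have "((\<lambda>v. A (u, v)) has_sum (\<Sum>v\<in>T. A (u, v))) (pverts G)"
    by (rule has_sum_finite_neutralI[OF fin(2) sub(2)])
       (use coupling_eq_0[OF assms] supp in auto)
  moreover have "((\<lambda>v. A (u, v)) has_sum \<mu> u) (pverts G)"
    using assms by (auto simp: couplings_def)
  ultimately show ?thesis by (rule has_sum_unique)
qed

lemma sum_column:
  assumes "A \<in> couplings G \<mu> \<nu>" "v \<in> pverts G"
  shows "(\<Sum>u\<in>S. A (u, v)) = \<nu> v"
proof -
  have "((\<lambda>u. A (u, v)) has_sum (\<Sum>u\<in>S. A (u, v))) (pverts G)"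
    by (rule has_sum_finite_neutralI[OF fin(1) sub(1)])
       (use coupling_eq_0[OF assms(1) _ assms(2)] supp in auto)
  moreover have "((\<lambda>u. A (u, v)) has_sum \<nu> v) (pverts G)"
    using assms by (auto simp: couplings_def)
  ultimately show ?thesis by (rule has_sum_unique)
qed

lemma transport_cost_eq:
  assumes "A \<in> couplings G \<mu> \<nu>"
  shows "transport_cost G A = (\<Sum>u\<in>S. \<Sum>v\<in>T. A (u, v) * real (gdist G u v))"
proof -
  have "u \<in> S \<and> v \<in> T" if "A (u, v) \<noteq> 0" "u \<in> pverts G" "v \<in> pverts G" for u v
    using coupling_eq_0[OF assms that(2,3)] supp that by blast
  then have "transport_cost G A = (\<Sum>\<^sub>\<infinity>(u, v)\<in>S \<times> T. A (u, v) * real (gdist G u v))"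
    using sub by (intro infsum_cong_neutral) auto
  also have "\<dots> = (\<Sum>(u, v)\<in>S \<times> T. A (u, v) * real (gdist G u v))"
    using fin by (intro infsum_finite) auto
  finally show ?thesis by (simp add: sum.cartesian_product)
qed

lemma transport_cost_nonneg:
  assumes "A \<in> couplings G \<mu> \<nu>"
  shows "0 \<le> transport_cost G A"
  using assms by (intro infsum_nonneg) (auto simp: couplings_def)

lemma wasserstein_le_transport_cost:
  assumes "A \<in> couplings G \<mu> \<nu>"
  shows "wasserstein G \<mu> \<nu> \<le> transport_cost G A"
  unfolding wasserstein_def
  by (rule cINF_lower[OF _ assms]) (auto intro!: bdd_belowI2 transport_cost_nonneg)

text \<open>Reduces the marginal conditions to finite sums. The bound
  \<open>A (u, v) \<le> 1\<close> comes from the row sum, since a nonnegative entry is at most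
  \<open>\<mu> u\<close>.\<close>

lemma couplingsI:
  assumes nonneg: "\<And>u v. u \<in> pverts G \<Longrightarrow> v \<in> pverts G \<Longrightarrow> 0 \<le> A (u, v)"
    and zero: "\<And>u v. u \<in> pverts G \<Longrightarrow> v \<in> pverts G \<Longrightarrow> u \<notin> S \<or> v \<notin> T \<Longrightarrow> A (u, v) = 0"
    and row: "\<And>u. u \<in> S \<Longrightarrow> (\<Sum>v\<in>T. A (u, v)) = \<mu> u"
    and col: "\<And>v. v \<in> T \<Longrightarrow> (\<Sum>u\<in>S. A (u, v)) = \<nu> v"
    and le1: "\<And>u. u \<in> S \<Longrightarrow> \<mu> u \<le> 1"
  shows "A \<in> couplings G \<mu> \<nu>"
proof -
  have "A (u, v) \<le> 1" if "u \<in> pverts G" "v \<in> pverts G" for u v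
  proof (cases "u \<in> S \<and> v \<in> T")
    case True
    then have "A (u, v) \<le> (\<Sum>v\<in>T. A (u, v))"
      using fin sub nonneg that by (intro member_le_sum) auto
    then show ?thesis using row le1 True by force
  qed (use zero that in auto)
  moreover have "((\<lambda>v. A (u, v)) has_sum \<mu> u) (pverts G)" if "u \<in> pverts G" for u
    using that row[of u] zero supp(1)[of u]
    by (intro has_sum_finite_neutralI[OF fin(2) sub(2)])
       (use sub in \<open>auto simp: subset_iff\<close>, cases "u \<in> S", auto)
  moreover have "((\<lambda>u. A (u, v)) has_sum \<nu> v) (pverts G)" if "v \<in> pverts G" for v
    using that col[of v] zero supp(2)[of v]
    by (intro has_sum_finite_neutralI[OF fin(1) sub(1)])
       (use sub in \<open>auto simp: subset_iff\<close>, cases "v \<in> T", auto)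
  ultimately show ?thesis using nonneg by (auto simp: couplings_def)
qed

text \<open>The product measure is a coupling. Nonemptiness is what allows lower bounds to pass to
  the infimum in \<open>wasserstein\<close>.\<close>

lemma couplings_nonempty:
  assumes "\<And>u. u \<in> S \<Longrightarrow> 0 \<le> \<mu> u" "\<And>v. v \<in> T \<Longrightarrow> 0 \<le> \<nu> v" "sum \<mu> S = 1" "sum \<nu> T = 1"
  shows "couplings G \<mu> \<nu> \<noteq> {}"
proof -
  have nn: "0 \<le> \<mu> u" "0 \<le> \<nu> u" if "u \<in> pverts G" for u
    using assms(1,2) supp[OF that] by (force, force)
  have "(\<lambda>(u, v). \<mu> u * \<nu> v) \<in> couplings G \<mu> \<nu>"
  proof (rule couplingsI)
    fix u assume "u \<in> S"
    then show "\<mu> u \<le> 1"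
      using member_le_sum[of u S \<mu>] assms(1,3) fin by simp
  qed (use nn supp assms(3,4) in \<open>auto simp flip: sum_distrib_left sum_distrib_right\<close>)
  then show ?thesis by blast
qed

text \<open>The easy half of duality: by the marginal conditions the left side is the integral of
  \<open>f v - f u\<close> against any coupling. As \<open>gdist\<close> is not symmetric, the
  Lipschitz condition is one-sided, in the direction of transport.\<close>

lemma Kantorovich_le_wasserstein:
  fixes f :: "'a \<Rightarrow> real"
  assumes ne: "couplings G \<mu> \<nu> \<noteq> {}"
    and lip: "\<And>u v. u \<in> pverts G \<Longrightarrow> v \<in> pverts G \<Longrightarrow> f v - f u \<le> real (gdist G u v)"
  shows "(\<Sum>v\<in>T. f v * \<nu> v) - (\<Sum>u\<in>S. f u * \<mu> u) \<le> wasserstein G \<mu> \<nu>"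
  unfolding wasserstein_def
proof (rule cINF_greatest[OF ne])
  fix A assume A: "A \<in> couplings G \<mu> \<nu>"
  have "(\<Sum>v\<in>T. f v * \<nu> v) = (\<Sum>v\<in>T. \<Sum>u\<in>S. f v * A (u, v))"
    using sum_column[OF A] sub
    by (intro sum.cong refl) (auto simp: subset_iff simp flip: sum_distrib_left)
  also have "\<dots> = (\<Sum>u\<in>S. \<Sum>v\<in>T. f v * A (u, v))"
    by (rule sum.swap)
  finally have "(\<Sum>v\<in>T. f v * \<nu> v) = (\<Sum>u\<in>S. \<Sum>v\<in>T. f v * A (u, v))" .
  moreover have "(\<Sum>u\<in>S. f u * \<mu> u) = (\<Sum>u\<in>S. \<Sum>v\<in>T. f u * A (u, v))"
    using sum_row[OF A] sub
    by (intro sum.cong refl) (auto simp: subset_iff simp flip: sum_distrib_left)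
  ultimately have "(\<Sum>v\<in>T. f v * \<nu> v) - (\<Sum>u\<in>S. f u * \<mu> u)
      = (\<Sum>u\<in>S. \<Sum>v\<in>T. A (u, v) * (f v - f u))"
    by (simp add: algebra_simps sum_subtractf)
  also have "\<dots> \<le> (\<Sum>u\<in>S. \<Sum>v\<in>T. A (u, v) * real (gdist G u v))"
    using A sub lip by (intro sum_mono mult_left_mono) (auto simp: couplings_def subset_iff)
  also have "\<dots> = transport_cost G A"
    using transport_cost_eq[OF A] by simp
  finally show "(\<Sum>v\<in>T. f v * \<nu> v) - (\<Sum>u\<in>S. f u * \<mu> u) \<le> transport_cost G A" .
qed

end

lemma couplings_mix:
  assumes "A \<in> couplings G \<mu> \<nu>" "B \<in> couplings G \<mu>' \<nu>'" "0 \<le> t" "t \<le> 1"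
  shows "(\<lambda>p. t * A p + (1 - t) * B p)
    \<in> couplings G (\<lambda>u. t * \<mu> u + (1 - t) * \<mu>' u) (\<lambda>v. t * \<nu> v + (1 - t) * \<nu>' v)"
  using assms unfolding couplings_def
  by (auto intro!: has_sum_add has_sum_cmult_right convex_bound_le)

text \<open>The limit is the supremum over the open interval, which inherits the bound
  \<open>c\<close>.\<close>

lemma at_left_limit_exists_of_mono_bounded:
  fixes h :: "real \<Rightarrow> real"
  assumes "a < b"
    and mono: "\<And>s t. a < s \<Longrightarrow> s \<le> t \<Longrightarrow> t < b \<Longrightarrow> h s \<le> h t"
    and bound: "\<And>t. a < t \<Longrightarrow> t < b \<Longrightarrow> h t \<le> c"
  obtains l where "(h \<longlongrightarrow> l) (at_left b)" "l \<le> c"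
proof
  let ?l = "SUP t\<in>{a<..<b}. h t"
  have ne: "{a<..<b} \<noteq> {}" using \<open>a < b\<close> by simp
  have bdd: "bdd_above (h ` {a<..<b})" using bound by (auto intro!: bdd_aboveI2)
  show "?l \<le> c" using ne bound by (intro cSUP_least) auto
  show "(h \<longlongrightarrow> ?l) (at_left b)"
  proof (rule increasing_tendsto)
    show "\<forall>\<^sub>F t in at_left b. h t \<le> ?l"
      using eventually_at_left_real[OF \<open>a < b\<close>] by eventually_elim (rule cSUP_upper[OF _ bdd])
  next
    fix y assume "y < ?l"
    then obtain s where s: "s \<in> {a<..<b}" "y < h s"
      using less_cSUP_iff[OF ne bdd] by auto
    then have "s < b" by simp
    from eventually_at_left_real[OF this] show "\<forall>\<^sub>F t in at_left b. y < h t"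
    proof eventually_elim
      case (elim t)
      then show ?case using s mono[of s t] by simp
    qed
  qed
qed

section \<open>Regular strongly connected digraphs\<close>

context pair_wf_digraph
begin

text \<open>\<open>gdist\<close> minimises over paths without repeated vertices. Cutting cycles out
  of a walk only shortens it, so any walk bounds the distance.\<close>

lemma ex_apath_length_le:
  assumes "awalk u p v"
  shows "\<exists>q. apath u q v \<and> length q \<le> length p"
  using assms
proof (induct rule: awalk_to_apath_induct)
  case (path p)
  then show ?case by (auto simp: apath_def)
next
  case (decomp p q r s)
  then have "p = q @ r @ s" by (auto elim: awalk_cyc_decompE)
  with decomp show ?case by force
qed

lemma gdist_le:
  assumes "awalk u p v"
  shows "gdist G u v \<le> length p"
proof -
  obtain q where "apath u q v" "length q \<le> length p"
    using ex_apath_length_le[OF assms] by blast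
  then show ?thesis
    unfolding gdist_def by (intro order_trans[OF Least_le]) auto
qed

end

text \<open>\<open>d_pos\<close> rules out the one-vertex graph, which has no edge and hence no edge
  of nonpositive curvature.\<close>

locale regular_strong_digraph = pair_loopfree_digraph G
  for G :: "'a pair_pre_digraph" +
  fixes d :: nat
  assumes antisym_arcs: "antisym (parcs G)"
    and locally_finite: "locally_finite_digraph G"
    and strong: "strongly_connected (with_proj G)"
    and d_pos: "d > 0"
    and regular: "x \<in> pverts G \<Longrightarrow> deg G x = d"
begin

section \<open>Directed distance\<close>

text \<open>By strong connectedness the \<open>LEAST\<close> in \<open>gdist\<close> is taken over a
  nonempty set, so it is attained.\<close>

lemma gdist_awalk:
  assumes "u \<in> pverts G" "v \<in> pverts G"
  obtains p where "awalk u p v" "length p = gdist G u v"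
proof -
  have "\<exists>n p. apath u p v \<and> length p = n"
    using assms strong reachable_apath by (auto simp: strongly_connected_def)
  from LeastI_ex[OF this] show ?thesis
    using that unfolding gdist_def by (auto simp: apath_def)
qed

lemma gdist_triangle:
  assumes "u \<in> pverts G" "v \<in> pverts G" "w \<in> pverts G"
  shows "gdist G u w \<le> gdist G u v + gdist G v w"
proof -
  obtain p where p: "awalk u p v" "length p = gdist G u v" using gdist_awalk assms by blast
  obtain q where q: "awalk v q w" "length q = gdist G v w" using gdist_awalk assms by blast
  show ?thesis using gdist_le[OF awalk_appendI[OF p(1) q(1)]] p q by simp
qed

lemma gdist_refl: "u \<in> pverts G \<Longrightarrow> gdist G u u = 0"
  using gdist_le[of u "[]" u] by (simp add: awalk_Nil_iff)

lemma gdist_pos: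
  assumes "u \<in> pverts G" "v \<in> pverts G" "u \<noteq> v"
  shows "1 \<le> gdist G u v"
proof -
  obtain p where "awalk u p v" "length p = gdist G u v" using gdist_awalk assms by blast
  then show ?thesis using assms by (cases p) (auto simp: awalk_Nil_iff)
qed

lemma gdist_arc:
  assumes "(u, v) \<in> parcs G"
  shows "gdist G u v = 1"
proof -
  have uv: "u \<in> pverts G" "v \<in> pverts G" "u \<noteq> v"
    using assms wellformed' pair_no_loops[OF assms] by auto
  then have "awalk u [(u, v)] v"
    using assms by (auto simp: awalk_Cons_iff awalk_Nil_iff)
  from gdist_le[OF this] gdist_pos[OF uv] show ?thesis by simp
qed

lemma gdist_non_arc:
  assumes "u \<in> pverts G" "v \<in> pverts G" "u \<noteq> v" "(u, v) \<notin> parcs G"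
  shows "2 \<le> gdist G u v"
proof -
  obtain p where p: "awalk u p v" "length p = gdist G u v" using gdist_awalk assms by blast
  have "length p \<noteq> 1"
    using p(1) assms by (auto simp: awalk_Nil_iff awalk_Cons_iff length_Suc_conv)
  then show ?thesis using p(2) gdist_pos assms(1-3) by fastforce
qed

section \<open>Out-neighbourhoods and the measures at vertices\<close>

lemma out_subset: "nbr_out G x \<subseteq> pverts G"
  using wellformed' by (auto simp: nbr_out_def)

lemma not_in_own_out: "x \<notin> nbr_out G x"
  using pair_no_loops[of "(x, x)"] by (auto simp: nbr_out_def)

lemma finite_out: "x \<in> pverts G \<Longrightarrow> finite (nbr_out G x)"
  using locally_finite by (auto simp: locally_finite_digraph_def nbr_def)

lemma deg_out_add_deg_in:
  assumes "x \<in> pverts G"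
  shows "deg_out G x + deg_in G x = d"
proof -
  \<comment> \<open>A common element would give a pair of opposite arcs, hence by antisymmetry a
    loop.\<close>
  have "nbr_in G x \<inter> nbr_out G x = {}"
    using antisym_arcs pair_no_loops by (fastforce simp: nbr_in_def nbr_out_def antisym_def)
  moreover have "finite (nbr_in G x)" "finite (nbr_out G x)"
    using assms locally_finite by (auto simp: locally_finite_digraph_def nbr_def)
  ultimately show ?thesis
    using regular[OF assms] by (simp add: deg_def deg_in_def deg_out_def nbr_def card_Un_disjoint)
qed

text \<open>Regularity eliminates the in-degree, so the measure depends only on \<open>d\<close> and
  the out-neighbourhood, and is affine in \<open>\<alpha>\<close>.\<close>

lemma vmeasure_eq:
  assumes "x \<in> pverts G"
  shows "vmeasure G \<alpha> x v =
    (if v = x then 1 - (1 - \<alpha>) / d * deg_out G x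
     else if v \<in> nbr_out G x then (1 - \<alpha>) / d else 0)"
proof -
  have deg_in: "real (deg_in G x) = real d - real (deg_out G x)"
    using deg_out_add_deg_in[OF assms] by linarith
  then have "\<alpha> + (1 - \<alpha>) / d * deg_in G x = 1 - (1 - \<alpha>) / d * deg_out G x"
    using d_pos unfolding deg_in by (simp add: right_diff_distrib)
  then show ?thesis
    using regular[OF assms] by (simp add: vmeasure_def nbr_out_def)
qed

lemma vmeasure_nonneg:
  assumes "x \<in> pverts G" "0 \<le> \<alpha>" "\<alpha> \<le> 1"
  shows "0 \<le> vmeasure G \<alpha> x v"
  using assms by (auto simp: vmeasure_def)

text \<open>Contains the support for every \<open>\<alpha>\<close>, including
  \<open>\<alpha> = 1\<close>, where all mass sits at \<open>x\<close>. Measures with different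
  parameters can thus be compared over the same finite set.\<close>

definition supp :: "'a \<Rightarrow> 'a set" where
  "supp x = insert x (nbr_out G x)"

lemma sum_vmeasure:
  fixes f :: "'a \<Rightarrow> real"
  assumes "x \<in> pverts G"
  shows "(\<Sum>v\<in>supp x. f v * vmeasure G \<alpha> x v) =
    f x * (1 - (1 - \<alpha>) / d * deg_out G x) + (1 - \<alpha>) / d * (\<Sum>v\<in>nbr_out G x. f v)"
proof -
  have "(\<Sum>v\<in>nbr_out G x. f v * vmeasure G \<alpha> x v) = (\<Sum>v\<in>nbr_out G x. (1 - \<alpha>) / d * f v)"
    using not_in_own_out[of x] by (intro sum.cong) (auto simp: vmeasure_eq[OF assms])
  then show ?thesis
    using finite_out[OF assms] not_in_own_out[of x]
    by (simp add: supp_def vmeasure_eq[OF assms] sum_distrib_left)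
qed

lemma sum_vmeasure_1: "x \<in> pverts G \<Longrightarrow> (\<Sum>v\<in>supp x. vmeasure G \<alpha> x v) = 1"
  using sum_vmeasure[of x "\<lambda>_. 1" \<alpha>] by (simp add: deg_out_def)

lemma finite_supports:
  assumes "x \<in> pverts G" "y \<in> pverts G"
  shows "finite_supports G (vmeasure G \<alpha> x) (vmeasure G \<beta> y) (supp x) (supp y)"
  using assms finite_out out_subset by unfold_locales (auto simp: supp_def vmeasure_eq)

lemma vmeasure_couplings_nonempty:
  assumes "x \<in> pverts G" "y \<in> pverts G" "0 \<le> \<alpha>" "\<alpha> \<le> 1"
  shows "couplings G (vmeasure G \<alpha> x) (vmeasure G \<alpha> y) \<noteq> {}"
proof -
  interpret finite_supports G "vmeasure G \<alpha> x" "vmeasure G \<alpha> y" "supp x" "supp y"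
    using assms finite_supports by blast
  show ?thesis
    using assms by (intro couplings_nonempty) (auto simp: vmeasure_nonneg sum_vmeasure_1)
qed

section \<open>Monotonicity of the scaled curvature\<close>

lemma wasserstein_mix_le:
  assumes xy: "(x, y) \<in> parcs G" and \<alpha>: "0 \<le> \<alpha>" "\<alpha> \<le> 1" and t: "0 \<le> t" "t \<le> 1"
    and \<beta>: "\<beta> = t * \<alpha> + (1 - t)"
  shows "wasserstein G (vmeasure G \<beta> x) (vmeasure G \<beta> y)
    \<le> t * wasserstein G (vmeasure G \<alpha> x) (vmeasure G \<alpha> y) + (1 - t)"
proof -
  have verts: "x \<in> pverts G" "y \<in> pverts G" using xy wellformed' by auto
  let ?C = "\<lambda>\<alpha>. couplings G (vmeasure G \<alpha> x) (vmeasure G \<alpha> y)"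
  let ?W = "\<lambda>\<alpha>. wasserstein G (vmeasure G \<alpha> x) (vmeasure G \<alpha> y)"
  note fs = finite_supports[OF verts]
  \<comment> \<open>The measure at parameter 1 is the point mass at \<open>z\<close>, and
    \<open>\<beta>\<close> is the average of \<open>\<alpha>\<close> and 1 with weights
    \<open>t\<close> and \<open>1 - t\<close>.\<close>
  have mix: "(\<lambda>u. t * vmeasure G \<alpha> z u + (1 - t) * vmeasure G 1 z u) = vmeasure G \<beta> z"
    if "z \<in> pverts G" for z
    by (auto simp: vmeasure_eq[OF that] \<beta> field_simps)
  define B :: "'a \<times> 'a \<Rightarrow> real" where "B = (\<lambda>p. if p = (x, y) then 1 else 0)"
  have B: "B \<in> ?C 1"
    by (rule finite_supports.couplingsI[OF fs])
       (use verts finite_out in \<open>auto simp: B_def supp_def vmeasure_eq if_distrib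
          sum.If_cases sum.delta cong: if_cong\<close>)
  have costB: "transport_cost G B = 1"
  proof -
    have "transport_cost G B = (\<Sum>(u, v)\<in>{(x, y)}. B (u, v) * real (gdist G u v))"
      using verts by (subst infsum_cong_neutral[where T = "{(x, y)}"])
        (auto simp: B_def split: if_splits)
    then show ?thesis by (simp add: B_def gdist_arc[OF xy])
  qed
  have le: "?W \<beta> \<le> t * transport_cost G A + (1 - t)" if A: "A \<in> ?C \<alpha>" for A
  proof -
    define M where "M = (\<lambda>p. t * A p + (1 - t) * B p)"
    have M: "M \<in> ?C \<beta>"
      using couplings_mix[OF A B t] by (simp add: M_def mix verts)
    have "transport_cost G M = t * transport_cost G A + (1 - t) * transport_cost G B"
      unfolding finite_supports.transport_cost_eq[OF fs M]
        finite_supports.transport_cost_eq[OF fs A] finite_supports.transport_cost_eq[OF fs B]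
      by (simp add: M_def algebra_simps sum.distrib sum_distrib_left sum_subtractf)
    then show ?thesis
      using finite_supports.wasserstein_le_transport_cost[OF fs M] costB by simp
  qed
  note ne = vmeasure_couplings_nonempty[OF verts \<alpha>]
  show ?thesis
  \<comment> \<open>For \<open>t = 0\<close> any single coupling suffices; otherwise the bound is
    divided by \<open>t\<close> before taking the infimum over \<open>A\<close>.\<close>
  proof (cases "t = 0")
    case True
    then show ?thesis using le ne by auto
  next
    case False
    then have "(?W \<beta> - (1 - t)) / t \<le> ?W \<alpha>"
      using le t unfolding wasserstein_def[of G "vmeasure G \<alpha> x"]
      by (intro cINF_greatest[OF ne]) (auto simp: field_simps)
    then show ?thesis using False t by (simp add: field_simps)
  qed
qed

lemma scaled_curvature_mono:
  assumes xy: "(x, y) \<in> parcs G" and "0 \<le> \<alpha>" "\<alpha> \<le> \<beta>" "\<beta> < 1"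
  shows "curvature_alpha G \<alpha> x y / (1 - \<alpha>) \<le> curvature_alpha G \<beta> x y / (1 - \<beta>)"
proof -
  \<comment> \<open>The weight for which \<open>\<beta>\<close> is the average of
    \<open>\<alpha>\<close> and 1. As \<open>gdist G x y = 1\<close>, mixing then says that
    \<open>1 - W\<close> at \<open>\<beta>\<close> is at least \<open>t\<close> times
    \<open>1 - W\<close> at \<open>\<alpha>\<close>.\<close>
  define t where "t = (1 - \<beta>) / (1 - \<alpha>)"
  have t: "0 < t" "t \<le> 1" "1 - \<beta> = t * (1 - \<alpha>)"
    using assms by (auto simp: t_def)
  then have \<beta>: "\<beta> = t * \<alpha> + (1 - t)" by (simp add: algebra_simps)
  have "t * curvature_alpha G \<alpha> x y \<le> curvature_alpha G \<beta> x y"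
    using wasserstein_mix_le[OF xy _ _ _ t(2) \<beta>] assms t gdist_arc[OF xy]
    by (simp add: curvature_alpha_def algebra_simps)
  then have "t * curvature_alpha G \<alpha> x y / (1 - \<beta>) \<le> curvature_alpha G \<beta> x y / (1 - \<beta>)"
    using assms by (intro divide_right_mono) auto
  then show ?thesis using t(1,3) by simp
qed

section \<open>Upper bound and existence of the limit\<close>

lemma scaled_curvature_le:
  assumes xy: "(x, y) \<in> parcs G" and disj: "nbr_out G x \<inter> nbr_out G y = {}"
    and \<alpha>: "0 \<le> \<alpha>" "\<alpha> < 1"
  shows "curvature_alpha G \<alpha> x y / (1 - \<alpha>) \<le> (real (deg_out G x) - real (deg_out G y)) / d"
proof -
  have verts: "x \<in> pverts G" "y \<in> pverts G" using xy wellformed' by auto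
  let ?f = "\<lambda>v. real (gdist G x v)"
  let ?e = "(1 - \<alpha>) / d"
  have "?f v - ?f u \<le> real (gdist G u v)" if "u \<in> pverts G" "v \<in> pverts G" for u v
    using gdist_triangle[of x u v] verts that by linarith
  then have "(\<Sum>v\<in>supp y. ?f v * vmeasure G \<alpha> y v) - (\<Sum>u\<in>supp x. ?f u * vmeasure G \<alpha> x u)
      \<le> wasserstein G (vmeasure G \<alpha> x) (vmeasure G \<alpha> y)"
    using vmeasure_couplings_nonempty[OF verts] \<alpha>
    by (intro finite_supports.Kantorovich_le_wasserstein[OF finite_supports[OF verts]]) auto
  moreover have "(\<Sum>u\<in>supp x. ?f u * vmeasure G \<alpha> x u) = ?e * deg_out G x"
  proof -
    have "(\<Sum>v\<in>nbr_out G x. ?f v) = deg_out G x"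
      by (simp add: nbr_out_def gdist_arc deg_out_def)
    then show ?thesis by (simp add: sum_vmeasure verts gdist_refl)
  qed
  \<comment> \<open>The mass \<open>1 - ?e * deg_out G y\<close> at \<open>y\<close> has distance 1
    from \<open>x\<close>, and the remaining \<open>?e * deg_out G y\<close> has distance at least
    2.\<close>
  moreover have "1 + ?e * deg_out G y \<le> (\<Sum>v\<in>supp y. ?f v * vmeasure G \<alpha> y v)"
  proof -
    have "2 \<le> ?f v" if "v \<in> nbr_out G y" for v
    proof -
      \<comment> \<open>Otherwise \<open>(x, y)\<close> and \<open>(y, x)\<close> would both be
        arcs.\<close>
      have "v \<noteq> x"
        using that xy antisym_arcs pair_no_loops by (fastforce simp: nbr_out_def antisym_def)
      moreover have "(x, v) \<notin> parcs G" using that disj by (auto simp: nbr_out_def)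
      ultimately show ?thesis using gdist_non_arc[of x v] verts out_subset that by fastforce
    qed
    then have "2 * deg_out G y \<le> (\<Sum>v\<in>nbr_out G y. ?f v)"
      using sum_mono[of "nbr_out G y" "\<lambda>_. 2" ?f] by (simp add: deg_out_def mult.commute)
    then have "?e * (2 * deg_out G y) \<le> ?e * (\<Sum>v\<in>nbr_out G y. ?f v)"
      using \<alpha> by (intro mult_left_mono) auto
    then show ?thesis
      unfolding sum_vmeasure[OF verts(2)] by (simp add: gdist_arc[OF xy] algebra_simps)
  qed
  ultimately have "curvature_alpha G \<alpha> x y \<le> ?e * deg_out G x - ?e * deg_out G y"
    by (simp add: curvature_alpha_def gdist_arc[OF xy])
  also have "\<dots> = (1 - \<alpha>) * ((real (deg_out G x) - real (deg_out G y)) / d)"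
    by (simp add: algebra_simps diff_divide_distrib)
  finally show ?thesis using \<alpha> by (simp add: pos_divide_le_eq mult.commute)
qed

text \<open>\<open>Lim\<close> is a definite description and tells nothing until convergence is
  known. Monotonicity together with the uniform upper bound on \<open>(0, 1)\<close> supplies it,
  and the bound survives in the limit.\<close>

lemma curvature_limit:
  assumes xy: "(x, y) \<in> parcs G" and disj: "nbr_out G x \<inter> nbr_out G y = {}"
  shows "((\<lambda>\<alpha>. curvature_alpha G \<alpha> x y / (1 - \<alpha>)) \<longlongrightarrow> curvature G x y) (at_left 1)"
    and "curvature G x y \<le> (real (deg_out G x) - real (deg_out G y)) / d"
proof -
  let ?h = "\<lambda>\<alpha>. curvature_alpha G \<alpha> x y / (1 - \<alpha>)"
  obtain l where l: "(?h \<longlongrightarrow> l) (at_left 1)" "l \<le> (real (deg_out G x) - real (deg_out G y)) / d"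
    by (rule at_left_limit_exists_of_mono_bounded[of 0 1 ?h])
       (use scaled_curvature_mono[OF xy] scaled_curvature_le[OF xy disj] in auto)
  moreover have "curvature G x y = l"
    unfolding curvature_def by (rule tendsto_Lim[OF _ l(1)]) simp
  ultimately show "(?h \<longlongrightarrow> curvature G x y) (at_left 1)"
    and "curvature G x y \<le> (real (deg_out G x) - real (deg_out G y)) / d" by auto
qed

section \<open>Transport along a matching\<close>

lemma wasserstein_le_1_of_matching:
  assumes xy: "(x, y) \<in> parcs G" and deg: "deg_out G x = deg_out G y"
    and \<phi>: "bij_betw \<phi> (nbr_out G x) (nbr_out G y)"
    and dist: "\<And>z. z \<in> nbr_out G x \<Longrightarrow> gdist G z (\<phi> z) = 1"
    and \<alpha>: "0 \<le> \<alpha>" "\<alpha> \<le> 1"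
  shows "wasserstein G (vmeasure G \<alpha> x) (vmeasure G \<alpha> y) \<le> 1"
proof -
  have verts: "x \<in> pverts G" "y \<in> pverts G" using xy wellformed' by auto
  note fs = finite_supports[OF verts]
  define e where "e = (1 - \<alpha>) / d"
  \<comment> \<open>Since \<open>x\<close> is not its own out-neighbour, redefining
    \<open>\<phi>\<close> there extends the matching to a bijection from \<open>supp x\<close> to
    \<open>supp y\<close>.\<close>
  define \<psi> where "\<psi> = \<phi>(x := y)"
  have \<psi>: "bij_betw \<psi> (supp x) (supp y)"
  proof -
    have "bij_betw \<psi> (nbr_out G x) (nbr_out G y)"
      using \<phi> not_in_own_out by (subst bij_betw_cong[of _ _ \<phi>]) (auto simp: \<psi>_def)
    then show ?thesis
      using notIn_Un_bij_betw[of x "nbr_out G x" \<psi> "nbr_out G y"] not_in_own_out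
      by (simp add: \<psi>_def supp_def)
  qed
  \<comment> \<open>Equal out-degrees make the mass kept at \<open>x\<close> equal to the mass kept
    at \<open>y\<close>.\<close>
  have \<psi>_measure: "vmeasure G \<alpha> y (\<psi> u) = vmeasure G \<alpha> x u" if "u \<in> supp x" for u
    using that \<phi> not_in_own_out deg
    by (auto simp: vmeasure_eq verts \<psi>_def supp_def bij_betw_def)
  have \<psi>_dist: "gdist G u (\<psi> u) = 1" if "u \<in> supp x" for u
    using that dist gdist_arc[OF xy] by (auto simp: \<psi>_def supp_def)
  \<comment> \<open>The plan sends all mass at \<open>u\<close> to \<open>\<psi> u\<close>, at
    distance 1, so its cost is the total mass 1.\<close>
  define A where "A = (\<lambda>(u, v). if u \<in> supp x \<and> v = \<psi> u then vmeasure G \<alpha> x u else 0)"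
  have fin: "finite (supp x)" "finite (supp y)" using verts finite_out by (auto simp: supp_def)
  have \<psi>_in: "\<psi> u \<in> supp y" if "u \<in> supp x" for u
    using \<psi> that by (auto simp: bij_betw_def)
  have A: "A \<in> couplings G (vmeasure G \<alpha> x) (vmeasure G \<alpha> y)"
  proof (rule finite_supports.couplingsI[OF fs])
    fix v assume "v \<in> supp y"
    then obtain w where w: "w \<in> supp x" "v = \<psi> w" using \<psi> by (auto simp: bij_betw_def)
    \<comment> \<open>By injectivity of \<open>\<psi>\<close>, only the preimage \<open>w\<close>
      contributes to column \<open>v\<close>.\<close>
    have "(\<Sum>u\<in>supp x. A (u, v)) = (\<Sum>u\<in>supp x. if u = w then vmeasure G \<alpha> x w else 0)"
      using w \<psi> by (intro sum.cong) (auto simp: A_def bij_betw_def inj_on_def)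
    then show "(\<Sum>u\<in>supp x. A (u, v)) = vmeasure G \<alpha> y v"
      using w fin by (simp add: \<psi>_measure)
  next
    fix u assume "u \<in> supp x"
    then show "vmeasure G \<alpha> x u \<le> 1"
      using member_le_sum[of u "supp x" "vmeasure G \<alpha> x"] fin \<alpha> verts
      by (simp add: sum_vmeasure_1 vmeasure_nonneg)
  qed (use fin \<psi>_in verts \<alpha> in \<open>auto simp: A_def vmeasure_nonneg\<close>)
  have "transport_cost G A = (\<Sum>u\<in>supp x. \<Sum>v\<in>supp y. A (u, v) * real (gdist G u v))"
    by (rule finite_supports.transport_cost_eq[OF fs A])
  also have "\<dots> = (\<Sum>u\<in>supp x. \<Sum>v\<in>supp y. if v = \<psi> u then vmeasure G \<alpha> x u else 0)"
    using \<psi>_dist by (intro sum.cong refl) (auto simp: A_def)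
  also have "\<dots> = 1"
    using fin \<psi>_in verts by (simp add: sum_vmeasure_1)
  finally show ?thesis
    using finite_supports.wasserstein_le_transport_cost[OF fs A] by simp
qed

lemma curvature_nonneg_of_matching:
  assumes xy: "(x, y) \<in> parcs G" and disj: "nbr_out G x \<inter> nbr_out G y = {}"
    and deg: "deg_out G x = deg_out G y"
    and \<phi>: "bij_betw \<phi> (nbr_out G x) (nbr_out G y)"
    and dist: "\<And>z. z \<in> nbr_out G x \<Longrightarrow> gdist G z (\<phi> z) = 1"
  shows "0 \<le> curvature G x y"
proof (rule tendsto_lowerbound[OF curvature_limit(1)[OF xy disj]])
  show "\<forall>\<^sub>F \<alpha> in at_left 1. 0 \<le> curvature_alpha G \<alpha> x y / (1 - \<alpha>)"
    using eventually_at_left_real[OF zero_less_one]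
  proof eventually_elim
    case (elim \<alpha>)
    then show ?case
      using wasserstein_le_1_of_matching[OF xy deg \<phi> dist, of \<alpha>] gdist_arc[OF xy]
      by (simp add: curvature_alpha_def)
  qed
qed simp

section \<open>Out-degrees along arcs and walks\<close>

text \<open>As \<open>d > 0\<close> there is a second vertex, possibly only an in-neighbour; the
  first arc of a walk from \<open>x\<close> to it leaves \<open>x\<close>.\<close>

lemma ex_out_arc:
  assumes "x \<in> pverts G"
  obtains y where "(x, y) \<in> parcs G"
proof -
  have "nbr G x \<noteq> {}" using regular[OF assms] d_pos by (auto simp: deg_def)
  then obtain z where "(z, x) \<in> parcs G \<or> (x, z) \<in> parcs G"
    by (auto simp: nbr_def nbr_in_def nbr_out_def)
  then have z: "z \<in> pverts G" "z \<noteq> x"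
    using wellformed' pair_no_loops[of "(x, x)"] by auto
  obtain p where "awalk x p z" using gdist_awalk assms z by blast
  then show ?thesis
    using z that by (cases p) (auto simp: awalk_Nil_iff awalk_Cons_iff)
qed

text \<open>Out-degrees are natural numbers, so a minimum is attained even in an infinite graph, and
  any arc leaving a minimiser qualifies.\<close>

lemma ex_arc_deg_out_le: "\<exists>(x, y)\<in>parcs G. deg_out G x \<le> deg_out G y"
proof -
  obtain x where x: "x \<in> pverts G"
    and min: "\<And>z. z \<in> pverts G \<Longrightarrow> deg_out G x \<le> deg_out G z"
  proof -
    have "\<exists>x. x \<in> pverts G" using strong by (auto simp: strongly_connected_def)
    from ex_has_least_nat[of "\<lambda>x. x \<in> pverts G" _ "deg_out G"] this show ?thesis
      using that by blast
  qed
  obtain y where "(x, y) \<in> parcs G" using ex_out_arc[OF x] .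
  then show ?thesis using min wellformed' by blast
qed

text \<open>The inequality propagates along walks, and there are walks in both directions between
  \<open>x\<close> and \<open>y\<close>.\<close>

lemma deg_out_constant:
  assumes "\<And>x y. (x, y) \<in> parcs G \<Longrightarrow> deg_out G y \<le> deg_out G x"
    and "x \<in> pverts G" "y \<in> pverts G"
  shows "deg_out G x = deg_out G y"
proof -
  have le: "deg_out G v \<le> deg_out G u" if "awalk u p v" for u p v
    using that
  proof (induction p arbitrary: u)
    case (Cons e p)
    then have "deg_out G (snd e) \<le> deg_out G u" "deg_out G v \<le> deg_out G (snd e)"
      using assms(1)[of "fst e" "snd e"] by (auto simp: awalk_Cons_iff)
    then show ?case by simp
  qed (simp add: awalk_Nil_iff)
  obtain p q where "awalk x p y" "awalk y q x" using gdist_awalk assms by metis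
  then show ?thesis using le by (intro antisym)
qed

end

section \<open>The four statements on curvature and out-degree\<close>

theorem mainTheorem3:
  fixes G :: "'a pair_pre_digraph" and d :: nat
  assumes "simple_digraph G"
    and "locally_finite_digraph G"
    and "strongly_connected (with_proj G)"
    and "d > 0"
    and "\<forall>x\<in>pverts G. deg G x = d"
    and "\<forall>(x, y)\<in>parcs G. nbr_out G x \<inter> nbr_out G y = {}"
  shows "(\<exists>(x, y)\<in>parcs G. curvature G x y \<le> 0) \<and>
    ((\<forall>(x, y)\<in>parcs G. curvature G x y \<ge> 0) \<longrightarrow> ricci_flat G) \<and>
    (ricci_flat G \<longrightarrow> (\<forall>x\<in>pverts G. \<forall>y\<in>pverts G. deg_out G x = deg_out G y)) \<and>
    ((\<forall>x\<in>pverts G. \<forall>y\<in>pverts G. deg_out G x = deg_out G y) \<and>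
     (\<forall>(u, v)\<in>parcs G. \<exists>\<phi>. bij_betw \<phi> (nbr_out G u) (nbr_out G v) \<and>
        (\<forall>x\<in>nbr_out G u. gdist G x (\<phi> x) = 1))
     \<longrightarrow> ricci_flat G)"
proof -
  interpret pair_loopfree_digraph G using assms(1) by (simp add: simple_digraph_def)
  interpret regular_strong_digraph G d
    using assms by unfold_locales (auto simp: simple_digraph_def)
  have disj: "nbr_out G x \<inter> nbr_out G y = {}" if "(x, y) \<in> parcs G" for x y
    using assms(6) that by auto
  have ub: "curvature G x y \<le> (real (deg_out G x) - real (deg_out G y)) / d"
    if "(x, y) \<in> parcs G" for x y
    using curvature_limit(2)[OF that disj[OF that]] .
  have le0: "curvature G x y \<le> 0" if "(x, y) \<in> parcs G" "deg_out G x \<le> deg_out G y" for x y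
    using that(2) by (intro order_trans[OF ub[OF that(1)]]) (simp add: divide_nonpos_nonneg)
  have const: "\<forall>x\<in>pverts G. \<forall>y\<in>pverts G. deg_out G x = deg_out G y"
    if nonneg: "\<forall>(x, y)\<in>parcs G. curvature G x y \<ge> 0"
  proof (intro ballI)
    fix x y assume "x \<in> pverts G" "y \<in> pverts G"
    moreover have "deg_out G v \<le> deg_out G u" if "(u, v) \<in> parcs G" for u v
    proof -
      have "0 \<le> (real (deg_out G u) - real (deg_out G v)) / d"
        using nonneg that ub[OF that] by fastforce
      then show ?thesis using d_pos by (simp add: zero_le_divide_iff)
    qed
    ultimately show "deg_out G x = deg_out G y" by (intro deg_out_constant)
  qed
  \<comment> \<open>With equal out-degrees the upper bound on curvature becomes 0, so nonnegativity
    forces equality. Parts 2 and 4 both end here.\<close>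
  have flat: "ricci_flat G"
    if "\<forall>x\<in>pverts G. \<forall>y\<in>pverts G. deg_out G x = deg_out G y"
      and "\<forall>(x, y)\<in>parcs G. curvature G x y \<ge> 0"
    unfolding ricci_flat_def
  proof clarify
    fix x y assume xy: "(x, y) \<in> parcs G"
    with that(1) wellformed' have "deg_out G x = deg_out G y" by blast
    with le0[OF xy] that(2) xy show "curvature G x y = 0" by fastforce
  qed
  show ?thesis
  proof (intro conjI impI)
    show "\<exists>(x, y)\<in>parcs G. curvature G x y \<le> 0"
      using ex_arc_deg_out_le le0 by blast
  next
    assume "\<forall>(x, y)\<in>parcs G. curvature G x y \<ge> 0"
    then show "ricci_flat G" using flat const by blast
  next
    \<comment> \<open>Zero curvature is in particular nonnegative, so \<open>const\<close>
      applies.\<close>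
    assume "ricci_flat G"
    then show "\<forall>x\<in>pverts G. \<forall>y\<in>pverts G. deg_out G x = deg_out G y"
      by (intro const) (auto simp: ricci_flat_def)
  next
    assume *: "(\<forall>x\<in>pverts G. \<forall>y\<in>pverts G. deg_out G x = deg_out G y) \<and>
     (\<forall>(u, v)\<in>parcs G. \<exists>\<phi>. bij_betw \<phi> (nbr_out G u) (nbr_out G v) \<and>
        (\<forall>x\<in>nbr_out G u. gdist G x (\<phi> x) = 1))"
    have "0 \<le> curvature G x y" if xy: "(x, y) \<in> parcs G" for x y
    proof -
      have "deg_out G x = deg_out G y"
        using * xy wellformed' by blast
      moreover obtain \<phi> where "bij_betw \<phi> (nbr_out G x) (nbr_out G y)"
        "\<And>z. z \<in> nbr_out G x \<Longrightarrow> gdist G z (\<phi> z) = 1"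
        using * xy by blast
      ultimately show ?thesis
        by (rule curvature_nonneg_of_matching[OF xy disj[OF xy]])
    qed
    then show "ricci_flat G" by (intro flat conjunct1[OF *]) blast
  qed
qed

end
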